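(* Let $(S,\triangleleft)$ and $(T,\triangleleft)$ be right racks and let $r_S$ and $r_T$ be the solutions associated with them, i.e. $r_S(a,b)=(b\triangleleft a,\,a)$ and $r_T(u,v)=(v\triangleleft u,\,u)$. If $(r_S,r_T,\alpha,\beta)$ is a matched product system of solutions, then the structure shelf operation of the matched product solution $r:=r_S\bowtie r_T$ is $$(a,u)\triangleright_{r}(b,v)=(b\triangleleft a,\ v\triangleleft u)$$ for all $a,b\in S$ and $u,v\in T$.
   Context: Solutions. A (set-theoretical) solution on a set $X$ is a map $r:X\times X\to X\times X$ with $(r\times\mathrm{id}_X)(\mathrm{id}_X\times r)(r\times\mathrm{id}_X)=(\mathrm{id}_X\times r)(r\times\mathrm{id}_X)(\mathrm{id}_X\times r)$. Write $r(x,y)=(\lambda_x(y),\rho_y(x))$. The solution $r$ is left non-degenerate if every $\lambda_x$ is bijective. Right racks. A right shelf is a set $X$ with a binary operation $\triangleleft$ such that $(x\triangleleft y)\triangleleft z=(x\triangleleft z)\triangleleft(y\triangleleft z)$ for all $x,y,z\in X$. The solution associated with it is $r_\triangleleft(x,y)=(y\triangleleft x,\,x)$. A right rack is a right shelf in which every map $R_y:X\to X$, $R_y(x)=x\triangleleft y$, is bijective. Structure shelf. If $r$ is a left non-degenerate solution on $X$, its structure shelf is $X$ with the operation $x\triangleright_r y:=\lambda_x\big(\rho_{\lambda_y^{-1}(x)}(y)\big)$. (In the present situation the matched product solution is left non-degenerate, so this applies.) $\mathrm{Sym}(X)$ is the group of bijections $X\to X$; juxtaposition of maps is composition, $fg=f\circ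 g$. Matched product systems. Given solutions $r_S$ on $S$ and $r_T$ on $T$ (components of both written $\lambda,\rho$, with $a,b\in S$ and $u,v\in T$) and maps $\alpha:T\to\mathrm{Sym}(S)$, $\beta:S\to\mathrm{Sym}(T)$, with $\alpha_u:=\alpha(u)$, $\beta_a:=\beta(a)$, the quadruple $(r_S,r_T,\alpha,\beta)$ is a matched product system of solutions if for all $a,b\in S$, $u,v\in T$: (s1) $\alpha_u\alpha_v=\alpha_{\lambda_u(v)}\alpha_{\rho_v(u)}$; (s2) $\beta_a\beta_b=\beta_{\lambda_a(b)}\beta_{\rho_b(a)}$; (s3) $\rho_{\alpha_u^{-1}(b)}\big(\alpha^{-1}_{\beta_a(u)}(a)\big)=\alpha^{-1}_{\beta_{\rho_b(a)}\beta_b^{-1}(u)}\big(\rho_b(a)\big)$; (s4) $\rho_{\beta_a^{-1}(v)}\big(\beta^{-1}_{\alpha_u(a)}(u)\big)=\beta^{-1}_{\alpha_{\rho_v(u)}\alpha_v^{-1}(a)}\big(\rho_v(u)\big)$; (s5) $\lambda_a\alpha_{\beta_a^{-1}(u)}=\alpha_u\lambda_{\alpha_u^{-1}(a)}$; (s6) $\lambda_u\beta_{\alpha_u^{-1}(a)}=\beta_a\lambda_{\beta_a^{-1}(u)}$. Matched product. For a matched product system, the matched product solution $r_S\bowtie r_T$ is the map on $(S\times T)\times(S\times T)$ (known to be a solution on $S\times T$) $$\big((a,u),(b,v)\big)\mapsto\Big(\big(A,U\big),\ \big(\alpha^{-1}_{\overline U}(\rho_{\alpha_{\bar u}(b)}(a)),\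 \beta^{-1}_{\overline A}(\rho_{\beta_{\bar a}(v)}(u))\big)\Big),$$ where $\bar a=\alpha_u^{-1}(a)$, $\bar u=\beta_a^{-1}(u)$, $A=\alpha_u(\lambda_{\bar a}(b))$, $U=\beta_a(\lambda_{\bar u}(v))$, $\overline A=\alpha_U^{-1}(A)$, $\overline U=\beta_A^{-1}(U)$. *)

theory Defs
  imports Main
begin

text \<open>Underlying sets are types, so a solution on a set is a total function on pairs.\<close>

definition on_first_two :: "('x \<times> 'x \<Rightarrow> 'x \<times> 'x) \<Rightarrow> 'x \<times> 'x \<times> 'x \<Rightarrow> 'x \<times> 'x \<times> 'x" where
  "on_first_two r = (\<lambda>(x, y, z). let (x', y') = r (x, y) in (x', y', z))"

definition on_last_two :: "('x \<times> 'x \<Rightarrow> 'x \<times> 'x) \<Rightarrow> 'x \<times> 'x \<times> 'x \<Rightarrow> 'x \<times> 'x \<times> 'x" where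
  "on_last_two r = (\<lambda>(x, y, z). (x, r (y, z)))"

definition is_solution :: "('x \<times> 'x \<Rightarrow> 'x \<times> 'x) \<Rightarrow> bool" where
  "is_solution r \<longleftrightarrow>
     on_first_two r \<circ> on_last_two r \<circ> on_first_two r =
     on_last_two r \<circ> on_first_two r \<circ> on_last_two r"

text \<open>Components \<open>r (x, y) = (lam r x y, rho r y x)\<close>: the subscript is the first argument,
  so the arguments of \<open>rho\<close> are swapped.\<close>

definition lam :: "('x \<times> 'x \<Rightarrow> 'x \<times> 'x) \<Rightarrow> 'x \<Rightarrow> 'x \<Rightarrow> 'x" where
  "lam r x y = fst (r (x, y))"

definition rho :: "('x \<times> 'x \<Rightarrow> 'x \<times> 'x) \<Rightarrow> 'x \<Rightarrow> 'x \<Rightarrow> 'x" where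
  "rho r y x = snd (r (x, y))"

definition left_nondegenerate :: "('x \<times> 'x \<Rightarrow> 'x \<times> 'x) \<Rightarrow> bool" where
  "left_nondegenerate r \<longleftrightarrow> (\<forall>x. bij (lam r x))"

text \<open>Meaningful for left non-degenerate \<open>r\<close>, where \<open>inv (lam r y)\<close> is a two-sided inverse.\<close>

definition structure_shelf :: "('x \<times> 'x \<Rightarrow> 'x \<times> 'x) \<Rightarrow> 'x \<Rightarrow> 'x \<Rightarrow> 'x" where
  "structure_shelf r x y = lam r x (rho r (inv (lam r y) x) y)"

locale right_shelf =
  fixes tri :: "'x \<Rightarrow> 'x \<Rightarrow> 'x"  (infixl \<open>\<triangleleft>\<close> 70)
  assumes self_distrib: "(x \<triangleleft> y) \<triangleleft> z = (x \<triangleleft> z) \<triangleleft> (y \<triangleleft> z)"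

locale right_rack = right_shelf +
  assumes bij_right: "bij (\<lambda>x. x \<triangleleft> y)"

definition shelf_solution :: "('x \<Rightarrow> 'x \<Rightarrow> 'x) \<Rightarrow> 'x \<times> 'x \<Rightarrow> 'x \<times> 'x" where
  "shelf_solution tri = (\<lambda>(x, y). (tri y x, x))"

locale matched_product_system =
  fixes rS :: "'s \<times> 's \<Rightarrow> 's \<times> 's"
    and rT :: "'t \<times> 't \<Rightarrow> 't \<times> 't"
    and \<alpha> :: "'t \<Rightarrow> 's \<Rightarrow> 's"
    and \<beta> :: "'s \<Rightarrow> 't \<Rightarrow> 't"
  assumes solution_S: "is_solution rS"
    and solution_T: "is_solution rT"
    and bij_\<alpha>: "bij (\<alpha> u)"
    and bij_\<beta>: "bij (\<beta> a)"
    and s1: "\<alpha> u \<circ> \<alpha> v = \<alpha> (lam rT u v) \<circ> \<alpha> (rho rT v u)"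
    and s2: "\<beta> a \<circ> \<beta> b = \<beta> (lam rS a b) \<circ> \<beta> (rho rS b a)"
    and s3: "rho rS (inv (\<alpha> u) b) (inv (\<alpha> (\<beta> a u)) a) =
             inv (\<alpha> (\<beta> (rho rS b a) (inv (\<beta> b) u))) (rho rS b a)"
    and s4: "rho rT (inv (\<beta> a) v) (inv (\<beta> (\<alpha> u a)) u) =
             inv (\<beta> (\<alpha> (rho rT v u) (inv (\<alpha> v) a))) (rho rT v u)"
    and s5: "lam rS a \<circ> \<alpha> (inv (\<beta> a) u) = \<alpha> u \<circ> lam rS (inv (\<alpha> u) a)"
    and s6: "lam rT u \<circ> \<beta> (inv (\<alpha> u) a) = \<beta> a \<circ> lam rT (inv (\<beta> a) u)"

text \<open>\<open>a'\<close>, \<open>u'\<close>, \<open>A'\<close>, \<open>U'\<close> stand for the barred elements.\<close>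

definition matched_product ::
  "('s \<times> 's \<Rightarrow> 's \<times> 's) \<Rightarrow> ('t \<times> 't \<Rightarrow> 't \<times> 't) \<Rightarrow> ('t \<Rightarrow> 's \<Rightarrow> 's) \<Rightarrow> ('s \<Rightarrow> 't \<Rightarrow> 't) \<Rightarrow>
   ('s \<times> 't) \<times> ('s \<times> 't) \<Rightarrow> ('s \<times> 't) \<times> ('s \<times> 't)" where
  "matched_product rS rT \<alpha> \<beta> = (\<lambda>((a, u), (b, v)).
     let a' = inv (\<alpha> u) a;
         u' = inv (\<beta> a) u;
         A = \<alpha> u (lam rS a' b);
         U = \<beta> a (lam rT u' v);
         A' = inv (\<alpha> U) A;
         U' = inv (\<beta> A) U
     in ((A, U), (inv (\<alpha> U') (rho rS (\<alpha> u' b) a), inv (\<beta> A') (rho rT (\<beta> a' v) u))))"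

text \<open>For racks the matched product is left non-degenerate, so its structure shelf is
  meaningful.\<close>

lemma (in right_shelf) is_solution_shelf_solution: "is_solution (shelf_solution (\<triangleleft>))"
  by (auto simp: is_solution_def on_first_two_def on_last_two_def shelf_solution_def fun_eq_iff
        intro: self_distrib[symmetric])

lemma (in right_rack) left_nondegenerate_shelf_solution:
  "left_nondegenerate (shelf_solution (\<triangleleft>))"
  using bij_right by (simp add: left_nondegenerate_def lam_def[abs_def] shelf_solution_def)

lemma (in matched_product_system) left_nondegenerate_matched_product:
  assumes "left_nondegenerate rS" and "left_nondegenerate rT"
  shows "left_nondegenerate (matched_product rS rT \<alpha> \<beta>)"
proof -
  have "bij (lam (matched_product rS rT \<alpha> \<beta>) (a, u))" for a u
  proof -
    have "lam (matched_product rS rT \<alpha> \<beta>) (a, u) =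
        map_prod (\<alpha> u \<circ> lam rS (inv (\<alpha> u) a)) (\<beta> a \<circ> lam rT (inv (\<beta> a) u))"
      by (auto simp: fun_eq_iff lam_def matched_product_def Let_def)
    moreover have "bij (\<alpha> u \<circ> lam rS (inv (\<alpha> u) a))"
      using assms bij_\<alpha> by (intro bij_comp) (auto simp: left_nondegenerate_def)
    moreover have "bij (\<beta> a \<circ> lam rT (inv (\<beta> a) u))"
      using assms bij_\<beta> by (intro bij_comp) (auto simp: left_nondegenerate_def)
    ultimately show ?thesis
      by (simp add: bij_def prod.inj_map map_prod_surj)
  qed
  then show ?thesis
    by (auto simp: left_nondegenerate_def)
qed

end

theory Submission
  imports Defs
begin

text \<open>For a rack solution \<open>\<rho>\<close> is trivial, \<open>\<rho>\<^sub>b(a) = a\<close>. Hence (s3) and (s4) no longer relate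
  \<open>\<rho>\<close> to the actions but restrict the actions themselves: \<open>\<alpha>\<close> is constant on the orbits of
  \<open>\<beta>\<close>, and \<open>\<beta>\<close> on those of \<open>\<alpha>\<close>. With this invariance (s5) and (s6) say that every \<open>\<alpha>\<^sub>u\<close> and
  every \<open>\<beta>\<^sub>a\<close> is an automorphism of its rack.

  Consequently the matched product has \<open>\<lambda>\<^bsub>(a,u)\<^esub>(b,v) = (\<alpha>\<^sub>u(b) \<triangleleft> a, \<beta>\<^sub>a(v) \<triangleleft> u)\<close>. If this value
  is \<open>(A,U)\<close>, the second component of the solution is \<open>(\<alpha>\<^sub>U\<inverse>(a), \<beta>\<^sub>A\<inverse>(u))\<close>.
  The structure shelf operation \<open>x \<triangleright> y = \<lambda>\<^sub>x(\<rho>\<^bsub>\<lambda>\<^sub>y\<inverse>(x)\<^esub>(y))\<close> evaluates \<open>\<rho>\<close> where this value is \<open>x\<close>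
  itself. So for \<open>x = (A,U)\<close> the map \<open>\<rho>\<close> undoes \<open>\<alpha>\<^sub>U\<close> and \<open>\<beta>\<^sub>A\<close>, the outer \<open>\<lambda>\<^sub>x\<close> applies them again,
  and only the rack operations remain.\<close>

lemma lam_shelf_solution [simp]: "lam (shelf_solution tri) x y = tri y x"
  by (simp add: lam_def shelf_solution_def)

lemma rho_shelf_solution [simp]: "rho (shelf_solution tri) y x = x"
  by (simp add: rho_def shelf_solution_def)

text \<open>The hypothesis is the shape of both (s3) and (s4) once \<open>\<rho>\<close> is trivial. Its left-hand side
  does not mention \<open>b\<close>, so varying \<open>b\<close> compares \<open>\<alpha>\<close> along the whole \<open>\<beta>\<close>-orbit of \<open>u\<close>.\<close>

lemma action_constant_on_orbits:
  fixes \<alpha> :: "'t \<Rightarrow> 's \<Rightarrow> 's" and \<beta> :: "'s \<Rightarrow> 't \<Rightarrow> 't"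
  assumes bij_\<alpha>: "\<And>u. bij (\<alpha> u)" and bij_\<beta>: "\<And>a. bij (\<beta> a)"
    and twist: "\<And>a b u. inv (\<alpha> (\<beta> a u)) a = inv (\<alpha> (\<beta> a (inv (\<beta> b) u))) a"
  shows "\<alpha> (\<beta> b u) = \<alpha> u"
proof -
  \<comment> \<open>The choice \<open>b = a\<close> handles the step along \<open>\<beta> a\<close>, but only at the point \<open>a\<close> itself.\<close>
  have own: "inv (\<alpha> (\<beta> a w)) a = inv (\<alpha> w) a" for a w
    using twist[of a w a] bij_\<beta>[of a] by (simp add: bij_is_surj surj_f_inv_f)
  have "inv (\<alpha> (\<beta> b u)) a = inv (\<alpha> u) a" for a
  proof -
    have "inv (\<alpha> (\<beta> b u)) a = inv (\<alpha> (\<beta> a (\<beta> b u))) a"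
      by (simp add: own)
    also have "\<dots> = inv (\<alpha> (\<beta> a u)) a"
      using twist[of a "\<beta> b u" b] bij_\<beta>[of b] by (simp add: bij_is_inj)
    also have "\<dots> = inv (\<alpha> u) a"
      by (rule own)
    finally show ?thesis .
  qed
  then have "inv (\<alpha> (\<beta> b u)) = inv (\<alpha> u)" ..
  then show ?thesis
    using bij_\<alpha> by (metis inv_inv_eq)
qed

lemma constant_on_inverse_orbits:
  assumes "surj g" and "\<And>u. f (g u) = f u"
  shows "f (inv g u) = f u"
  using assms(2)[of "inv g u"] assms(1) by (simp add: surj_f_inv_f)

theorem proposition7:
  fixes triS :: "'s \<Rightarrow> 's \<Rightarrow> 's"  (infixl "\<triangleleft>\<^sub>S" 70)
    and triT :: "'t \<Rightarrow> 't \<Rightarrow> 't"  (infixl "\<triangleleft>\<^sub>T" 70)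
    and \<alpha> :: "'t \<Rightarrow> 's \<Rightarrow> 's"
    and \<beta> :: "'s \<Rightarrow> 't \<Rightarrow> 't"
    and a b :: 's and u v :: 't
  assumes "right_rack (\<triangleleft>\<^sub>S)" and "right_rack (\<triangleleft>\<^sub>T)"
    and "matched_product_system (shelf_solution (\<triangleleft>\<^sub>S)) (shelf_solution (\<triangleleft>\<^sub>T)) \<alpha> \<beta>"
  shows "structure_shelf
           (matched_product (shelf_solution (\<triangleleft>\<^sub>S)) (shelf_solution (\<triangleleft>\<^sub>T)) \<alpha> \<beta>)
           (a, u) (b, v) = (b \<triangleleft>\<^sub>S a, v \<triangleleft>\<^sub>T u)"
proof -
  let ?r = "matched_product (shelf_solution (\<triangleleft>\<^sub>S)) (shelf_solution (\<triangleleft>\<^sub>T)) \<alpha> \<beta>"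
  interpret matched_product_system "shelf_solution (\<triangleleft>\<^sub>S)" "shelf_solution (\<triangleleft>\<^sub>T)" \<alpha> \<beta>
    by (rule assms(3))
  have \<alpha>_cancel: "\<alpha> w (inv (\<alpha> w) c) = c" for w c
    by (simp add: bij_\<alpha> bij_is_surj surj_f_inv_f)
  have \<beta>_cancel: "\<beta> c (inv (\<beta> c) w) = w" for w c
    by (simp add: bij_\<beta> bij_is_surj surj_f_inv_f)
  have \<alpha>_orbit: "\<alpha> (\<beta> c w) = \<alpha> w" for c w
    using s3 by (intro action_constant_on_orbits bij_\<alpha> bij_\<beta>) simp
  have \<beta>_orbit: "\<beta> (\<alpha> w c) = \<beta> c" for c w
    using s4 by (intro action_constant_on_orbits bij_\<alpha> bij_\<beta>) simp
  have \<alpha>_inv_orbit: "\<alpha> (inv (\<beta> c) w) = \<alpha> w" for c w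
    by (rule constant_on_inverse_orbits) (simp_all add: \<alpha>_orbit bij_\<beta> bij_is_surj)
  have \<beta>_inv_orbit: "\<beta> (inv (\<alpha> w) c) = \<beta> c" for c w
    by (rule constant_on_inverse_orbits) (simp_all add: \<beta>_orbit bij_\<alpha> bij_is_surj)
  have \<alpha>_aut: "\<alpha> w (d \<triangleleft>\<^sub>S inv (\<alpha> w) c) = \<alpha> w d \<triangleleft>\<^sub>S c" for w c d
    using fun_cong[OF s5[of c w], of d] by (simp add: \<alpha>_inv_orbit)
  have \<beta>_aut: "\<beta> c (z \<triangleleft>\<^sub>T inv (\<beta> c) w) = \<beta> c z \<triangleleft>\<^sub>T w" for w c z
    using fun_cong[OF s6[of w c], of z] by (simp add: \<beta>_inv_orbit)
  have lam_r: "lam ?r (c, w) (d, z) = (\<alpha> w d \<triangleleft>\<^sub>S c, \<beta> c z \<triangleleft>\<^sub>T w)" for c w d z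
    unfolding lam_def[of ?r]
    by (simp add: matched_product_def Let_def \<alpha>_aut \<beta>_aut)
  have rho_r: "rho ?r p (b, v) = (inv (\<alpha> U) b, inv (\<beta> A) v)"
    if "lam ?r (b, v) p = (A, U)" for p A U
    using that unfolding lam_def[of ?r] rho_def[of ?r]
    by (cases p) (auto simp: matched_product_def Let_def \<alpha>_inv_orbit \<beta>_inv_orbit)
  have "bij (lam ?r (b, v))"
    using left_nondegenerate_matched_product
      right_rack.left_nondegenerate_shelf_solution[OF assms(1)]
      right_rack.left_nondegenerate_shelf_solution[OF assms(2)]
    by (simp add: left_nondegenerate_def)
  then have "lam ?r (b, v) (inv (lam ?r (b, v)) (a, u)) = (a, u)"
    by (simp add: bij_is_surj surj_f_inv_f)
  then have "rho ?r (inv (lam ?r (b, v)) (a, u)) (b, v) = (inv (\<alpha> u) b, inv (\<beta> a) v)"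
    by (rule rho_r)
  then show ?thesis
    by (simp add: structure_shelf_def lam_r \<alpha>_cancel \<beta>_cancel)
qed

end
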